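(* Let $X=X_\sigma$ be an affine toric variety with cone $\sigma$, let $p$ be the primitive vector on a ray $\rho$ of $\sigma$, let $e_1,e_2$ be Demazure roots of $X_\sigma$ corresponding to $p$, and endow $X$ with the monoid structure of corank one given by the comultiplication $$\chi^u\mapsto\chi^u\otimes\chi^u\,(1\otimes\chi^{e_1}+\chi^{e_2}\otimes1)^{\langle p,u\rangle},\qquad u\in S_\sigma.$$ Then for any face $\gamma$ of the cone $\sigma$ the set of idempotents $E_\gamma$ in the torus orbit $O_\gamma\subseteq X$ is as follows: (a) $E_\gamma=\{x_\gamma\}$ if $\rho$ is a ray of $\gamma$; (b) $E_\gamma=\varnothing$ if $\rho$ is not a ray of $\gamma$ and $e_1,e_2\notin\gamma^\perp$; (c) $E_\gamma=\varnothing$ if $\rho$ is not a ray of $\gamma$ and $e_1,e_2\in\gamma^\perp$; (d) $E_\gamma=O_\gamma\cap\{\chi^u=1\ \ \forall u\in\mathrm{cone}(\gamma,\rho)^\perp\cap S_\sigma\}$ otherwise (i.e. if $\rho$ is not a ray of $\gamma$ and exactly one of $e_1,e_2$ belongs to $\gamma^\perp$).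
   Context: The ground field $\mathbb K$ is algebraically closed of characteristic zero. $N$ is a lattice of rank $n$, $N_{\mathbb Q}=N\otimes_{\mathbb Z}\mathbb Q$, $M=\mathrm{Hom}(N,\mathbb Z)$, $M_{\mathbb Q}=M\otimes_{\mathbb Z}\mathbb Q$, with pairing $\langle\cdot,\cdot\rangle$. For a strongly convex polyhedral cone $\sigma\subseteq N_{\mathbb Q}$: $\sigma^\vee=\{u\in M_{\mathbb Q}\mid\langle v,u\rangle\ge0\ \forall v\in\sigma\}$, $S_\sigma=M\cap\sigma^\vee$, $X_\sigma=\mathrm{Spec}\bigoplus_{u\in S_\sigma}\mathbb K\chi^u$ with $\chi^u\chi^{u'}=\chi^{u+u'}$. A ray is a one-dimensional face. If $p_1,\dots,p_m$ are the primitive lattice vectors on the rays of $\sigma$, a Demazure root corresponding to $p_i$ is $e\in M$ with $\langle p_i,e\rangle=-1$ and $\langle p_j,e\rangle\ge0$ for $j\ne i$. The comultiplication is dual to the multiplication $(x,y)\mapsto x*y$; explicitly, $\chi^u(x*y)=\sum_{i+j=\langle p,u\rangle}\binom{\langle p,u\rangle}{i}\chi^{u+ie_2}(x)\chi^{u+je_1}(y)$. (This is an associative multiplication with unity, whose group of invertible elements has a maximal torus of codimension one.) For $\tau\subseteq N_{\mathbb Q}$, $\tau^\perp=\{u\in M_{\mathbb Q}\mid\langle v,u\rangle=0\ \forall v\in\tau\}$; $\mathrm{cone}(\gamma,\rho)$ is the cone generated by $\gamma$ and $\rho$. Points of $X_\sigma$ correspond to semigroup homomorphisms $S_\sigma\to(\mathbb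 K,\cdot)$ (with $0\mapsto1$), $x\mapsto(u\mapsto\chi^u(x))$. The torus $\mathbb T=\mathrm{Hom}(M,\mathbb K^\times)$ acts on $X_\sigma$ and its orbits are $O_\gamma$ for faces $\gamma$ of $\sigma$ (including $0$ and $\sigma$): $O_\gamma$ is the set of $x$ with $\chi^u(x)\ne0$ for $u\in\gamma^\perp\cap S_\sigma$ and $\chi^u(x)=0$ for $u\in S_\sigma\setminus\gamma^\perp$. The distinguished point $x_\gamma\in O_\gamma$ is given by $\chi^u(x_\gamma)=1$ if $u\in\gamma^\perp$ and $\chi^u(x_\gamma)=0$ otherwise. An idempotent is $x\in X$ with $x*x=x$. *)

theory Defs
  imports "HOL-Analysis.Analysis" "HOL-Library.Poly_Mapping"
begin

(* N and M are both int^'n, where CARD('n) is the rank; M is identified with Hom(N, Z) by means of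
   the dual basis, so that the pairing is the standard scalar product. Likewise for N_Q and M_Q. *)

definition pairing :: "int^'n \<Rightarrow> int^'n \<Rightarrow> int" where
  "pairing v u = scalar_product v u"

definition pairingQ :: "rat^'n \<Rightarrow> rat^'n \<Rightarrow> rat" where
  "pairingQ v u = scalar_product v u"

definition to_Q :: "int^'n \<Rightarrow> rat^'n" where
  "to_Q v = (\<chi> i. of_int (v $ i))"

lemma pairingQ_to_Q: "pairingQ (to_Q v) (to_Q u) = of_int (pairing v u)"
  by (simp add: pairingQ_def pairing_def to_Q_def scalar_product_def)


section \<open>Rational polyhedral cones\<close>

definition cone_gen :: "(rat^'n) set \<Rightarrow> (rat^'n) set" where
  "cone_gen A = {\<Sum>v\<in>F. c v *s v | F c. finite F \<and> F \<subseteq> A \<and> (\<forall>v\<in>F. 0 \<le> c v)}"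

definition polyhedral_cone :: "(rat^'n) set \<Rightarrow> bool" where
  "polyhedral_cone \<sigma> \<longleftrightarrow> (\<exists>G. finite G \<and> \<sigma> = cone_gen G)"

definition strongly_convex :: "(rat^'n) set \<Rightarrow> bool" where
  "strongly_convex \<sigma> \<longleftrightarrow> (\<forall>v. v \<in> \<sigma> \<and> - v \<in> \<sigma> \<longrightarrow> v = 0)"

definition dual_cone :: "(rat^'n) set \<Rightarrow> (rat^'n) set" where
  "dual_cone \<sigma> = {u. \<forall>v\<in>\<sigma>. 0 \<le> pairingQ v u}"

definition perp :: "(rat^'n) set \<Rightarrow> (rat^'n) set" where
  "perp \<tau> = {u. \<forall>v\<in>\<tau>. pairingQ v u = 0}"

definition cone_face :: "(rat^'n) set \<Rightarrow> (rat^'n) set \<Rightarrow> bool" where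
  "cone_face \<gamma> \<sigma> \<longleftrightarrow> (\<exists>u\<in>dual_cone \<sigma>. \<gamma> = {v\<in>\<sigma>. pairingQ v u = 0})"

definition cone_ray :: "(rat^'n) set \<Rightarrow> (rat^'n) set \<Rightarrow> bool" where
  "cone_ray \<rho> \<sigma> \<longleftrightarrow> cone_face \<rho> \<sigma> \<and> vec.dim \<rho> = 1"

definition primitive :: "int^'n \<Rightarrow> bool" where
  "primitive p \<longleftrightarrow> p \<noteq> 0 \<and> (\<forall>k q. p = k *s q \<longrightarrow> \<bar>k\<bar> = 1)"

definition primitive_on :: "int^'n \<Rightarrow> (rat^'n) set \<Rightarrow> bool" where
  "primitive_on p \<rho> \<longleftrightarrow> primitive p \<and> to_Q p \<in> \<rho>"

definition ray_vectors :: "(rat^'n) set \<Rightarrow> (int^'n) set" where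
  "ray_vectors \<sigma> = {q. \<exists>\<rho>. cone_ray \<rho> \<sigma> \<and> primitive_on q \<rho>}"

definition demazure_root :: "(rat^'n) set \<Rightarrow> int^'n \<Rightarrow> int^'n \<Rightarrow> bool" where
  "demazure_root \<sigma> p e \<longleftrightarrow>
     pairing p e = -1 \<and> (\<forall>q\<in>ray_vectors \<sigma>. q \<noteq> p \<longrightarrow> 0 \<le> pairing q e)"


section \<open>Affine toric varieties\<close>

definition dual_semigroup :: "(rat^'n) set \<Rightarrow> (int^'n) set" where
  "dual_semigroup \<sigma> = {u. to_Q u \<in> dual_cone \<sigma>}"

(* The group algebra of M is int^'n =>0 'k with the convolution product. *)

definition chr :: "int^'n \<Rightarrow> (int^'n \<Rightarrow>\<^sub>0 'k::field)" where
  "chr u = Poly_Mapping.single u 1"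

definition coord_ring :: "(rat^'n) set \<Rightarrow> (int^'n \<Rightarrow>\<^sub>0 'k::field) set" where
  "coord_ring \<sigma> = {f. Poly_Mapping.keys f \<subseteq> dual_semigroup \<sigma>}"

(* Points of Spec over the (algebraically closed) ground field are the homomorphisms of K-algebras
   from the coordinate ring to K; the value of a regular function f at a point x is then x f.
   A point is normalised to be undefined outside of the coordinate ring.*)

type_synonym ('k, 'n) point = "(int^'n \<Rightarrow>\<^sub>0 'k) \<Rightarrow> 'k"

definition toric_variety :: "(rat^'n) set \<Rightarrow> ('k::field, 'n) point set" where
  "toric_variety \<sigma> = {x \<in> extensional (coord_ring \<sigma>).
     (\<forall>c. x (Poly_Mapping.single 0 c) = c) \<and>
     (\<forall>f\<in>coord_ring \<sigma>. \<forall>g\<in>coord_ring \<sigma>. x (f + g) = x f + x g \<and> x (f * g) = x f * x g)}"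

definition torus_orbit :: "(rat^'n) set \<Rightarrow> (rat^'n) set \<Rightarrow> ('k::field, 'n) point set" where
  "torus_orbit \<sigma> \<gamma> = {x \<in> toric_variety \<sigma>.
     (\<forall>u\<in>dual_semigroup \<sigma>. to_Q u \<in> perp \<gamma> \<longrightarrow> x (chr u) \<noteq> 0) \<and>
     (\<forall>u\<in>dual_semigroup \<sigma>. to_Q u \<notin> perp \<gamma> \<longrightarrow> x (chr u) = 0)}"

(* The linear extension of the values on characters given in chr_distinguished_point. *)

definition distinguished_point :: "(rat^'n) set \<Rightarrow> (rat^'n) set \<Rightarrow> ('k::field, 'n) point" where
  "distinguished_point \<sigma> \<gamma> = restrict
     (\<lambda>f. \<Sum>u\<in>Poly_Mapping.keys f. if to_Q u \<in> perp \<gamma> then Poly_Mapping.lookup f u else 0)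
     (coord_ring \<sigma>)"


section \<open>The multiplication of corank one\<close>

(* The tensor square of the group algebra of M is the group algebra of M \<times> M, where chr u \<otimes> chr w
   is the basis element of (u, w). *)

definition chr_tensor :: "int^'n \<Rightarrow> int^'n \<Rightarrow> ((int^'n) \<times> (int^'n) \<Rightarrow>\<^sub>0 'k::field)" where
  "chr_tensor u w = Poly_Mapping.single (u, w) 1"

definition comult_chr ::
    "int^'n \<Rightarrow> int^'n \<Rightarrow> int^'n \<Rightarrow> int^'n \<Rightarrow> ((int^'n) \<times> (int^'n) \<Rightarrow>\<^sub>0 'k::field)" where
  "comult_chr p e1 e2 u =
     chr_tensor u u * (chr_tensor 0 e1 + chr_tensor e2 0) ^ nat (pairing p u)"

definition comult ::
    "int^'n \<Rightarrow> int^'n \<Rightarrow> int^'n \<Rightarrow> (int^'n \<Rightarrow>\<^sub>0 'k::field) \<Rightarrow> ((int^'n) \<times> (int^'n) \<Rightarrow>\<^sub>0 'k)" where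
  "comult p e1 e2 f = (\<Sum>u\<in>Poly_Mapping.keys f.
     Poly_Mapping.single 0 (Poly_Mapping.lookup f u) * comult_chr p e1 e2 u)"

definition tensor_eval ::
    "('k::field, 'n) point \<Rightarrow> ('k, 'n) point \<Rightarrow> ((int^'n) \<times> (int^'n) \<Rightarrow>\<^sub>0 'k) \<Rightarrow> 'k" where
  "tensor_eval x y g = (\<Sum>(u, w)\<in>Poly_Mapping.keys g.
     Poly_Mapping.lookup g (u, w) * (x (chr u) * y (chr w)))"

definition point_mult ::
    "(rat^'n) set \<Rightarrow> int^'n \<Rightarrow> int^'n \<Rightarrow> int^'n
       \<Rightarrow> ('k::field, 'n) point \<Rightarrow> ('k, 'n) point \<Rightarrow> ('k, 'n) point" where
  "point_mult \<sigma> p e1 e2 x y =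
     restrict (\<lambda>f. tensor_eval x y (comult p e1 e2 f)) (coord_ring \<sigma>)"

definition idempotents ::
    "(rat^'n) set \<Rightarrow> int^'n \<Rightarrow> int^'n \<Rightarrow> int^'n \<Rightarrow> ('k::field, 'n) point set" where
  "idempotents \<sigma> p e1 e2 = {x \<in> toric_variety \<sigma>. point_mult \<sigma> p e1 e2 x x = x}"


section \<open>Consistency checks\<close>

lemma chr_in_coord_ring [simp]: "chr u \<in> coord_ring \<sigma> \<longleftrightarrow> u \<in> dual_semigroup \<sigma>"
  by (simp add: coord_ring_def chr_def)

lemma chr_mult: "chr (u + w) = (chr u * chr w :: _ \<Rightarrow>\<^sub>0 'k::field)"
  by (simp add: chr_def mult_single)

lemma chr_distinguished_point:
  assumes "u \<in> dual_semigroup \<sigma>"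
  shows "distinguished_point \<sigma> \<gamma> (chr u) = (if to_Q u \<in> perp \<gamma> then 1 else 0)"
  using chr_in_coord_ring[THEN iffD2, OF assms]
  by (simp add: distinguished_point_def) (simp add: chr_def)

lemma tensor_eval_superset:
  assumes "finite A" "Poly_Mapping.keys g \<subseteq> A"
  shows "tensor_eval x y g =
    (\<Sum>(u, w)\<in>A. Poly_Mapping.lookup g (u, w) * (x (chr u) * y (chr w)))"
  unfolding tensor_eval_def using assms
  by (intro sum.mono_neutral_left) (auto simp: in_keys_iff)

lemma tensor_eval_0 [simp]: "tensor_eval x y 0 = 0"
  by (simp add: tensor_eval_def)

lemma tensor_eval_add: "tensor_eval x y (f + g) = tensor_eval x y f + tensor_eval x y g"
proof -
  let ?A = "Poly_Mapping.keys f \<union> Poly_Mapping.keys g"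
  have "Poly_Mapping.keys (f + g) \<subseteq> ?A" by (rule keys_add)
  then show ?thesis
    by (simp add: tensor_eval_superset[of ?A] lookup_add ring_distribs
        sum.distrib case_prod_unfold)
qed

lemma tensor_eval_sum: "tensor_eval x y (sum f A) = (\<Sum>a\<in>A. tensor_eval x y (f a))"
  by (induction A rule: infinite_finite_induct) (auto simp: tensor_eval_add)

lemma tensor_eval_single:
  "tensor_eval x y (Poly_Mapping.single (u, w) c) = c * (x (chr u) * y (chr w))"
  by (subst tensor_eval_superset[of "{(u, w)}"]) auto

lemma chr_tensor_power: "chr_tensor u w ^ m = chr_tensor (of_nat m *s u) (of_nat m *s w)"
proof (induction m)
  case 0
  then show ?case by (simp add: chr_tensor_def flip: zero_prod_def)
next
  case (Suc m)
  then show ?case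
    by (simp add: chr_tensor_def mult_single vector_sadd_rdistrib)
qed

lemma point_mult_chr:
  fixes x y :: "('k::field, 'n::finite) point" and p e1 e2 u :: "int^'n"
  assumes "u \<in> dual_semigroup \<sigma>"
  defines "m \<equiv> nat (pairing p u)"
  shows "point_mult \<sigma> p e1 e2 x y (chr u) =
    (\<Sum>i\<le>m. of_nat (m choose i) * x (chr (u + int i *s e2)) * y (chr (u + int (m - i) *s e1)))"
proof -
  have "comult_chr p e1 e2 u = (\<Sum>i\<le>m. Poly_Mapping.single
      (u + int i *s e2, u + int (m - i) *s e1) (of_nat (m choose i) :: 'k))"
    unfolding comult_chr_def m_def[symmetric]
    by (simp add: add.commute[of "chr_tensor 0 e1"] binomial_ring sum_distrib_left chr_tensor_power)
      (simp add: chr_tensor_def mult_single mult.assoc flip: single_of_nat zero_prod_def)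
  then have "tensor_eval x y (comult_chr p e1 e2 u) = (\<Sum>i\<le>m. of_nat (m choose i) *
      x (chr (u + int i *s e2)) * y (chr (u + int (m - i) *s e1)))"
    by (simp add: tensor_eval_sum tensor_eval_single mult.assoc)
  moreover have "comult p e1 e2 (chr u :: _ \<Rightarrow>\<^sub>0 'k) = comult_chr p e1 e2 u"
    by (simp add: comult_def) (simp add: chr_def)
  ultimately show ?thesis
    using assms by (simp add: point_mult_def)
qed

end

theory Submission
  imports Defs
begin

text \<open>
  A point is determined by its values on the characters \<open>\<chi>\<^sup>u\<close> with \<open>u\<close> in \<open>S\<^sub>\<sigma>\<close>, and \<open>x\<close> is idempotent iff
  for every such \<open>u\<close>, with \<open>m = \<langle>p, u\<rangle>\<close> called the weight of \<open>u\<close>, the value of \<open>\<chi>\<^sup>u\<close> at \<open>x\<close> equals the sum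
  over \<open>i + j = m\<close> of the products of \<open>m choose i\<close> with the values at \<open>u + i *s e2\<close> and \<open>u + j *s e1\<close>
  (\<open>idempotent_iff\<close>). On the orbit of \<open>\<gamma>\<close>, the nonzero values are those at characters in \<open>perp \<gamma>\<close>, so
  a term survives iff both of its characters lie in \<open>perp \<gamma>\<close>. In weight zero the equation forces the
  value one on \<open>perp \<gamma>\<close> (\<open>idempotent_chr_eq_one\<close>), and the cases of the theorem differ in what
  happens in positive weight.

  If \<open>\<rho>\<close> is a ray of \<open>\<gamma>\<close>, then all of \<open>perp \<gamma>\<close> has weight zero, so an idempotent in the orbit is the
  distinguished point; this point is idempotent because for \<open>u\<close> outside of \<open>perp \<gamma>\<close> no term survives
  (\<open>distinguished_point_idempotent\<close>). Otherwise \<open>perp \<gamma>\<close> contains a character \<open>u\<close> of positive weight. If neither root is in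
  \<open>perp \<gamma>\<close>, no term of its equation survives. If both are, then \<open>u\<close> can be translated to
  weight one, where the equation becomes \<open>1 = 1 + 1\<close>. If exactly one is, then one term survives for every
  character in \<open>perp \<gamma>\<close>, and the equation follows from the value being one in weight zero.

  The geometric input is that the characters in the expansion belong to \<open>S\<^sub>\<sigma>\<close> in the first place.
  Demazure roots are defined by their values on the ray vectors only, so this rests on the
  fact that a pointed polyhedral cone is generated by its rays (\<open>dual_cone_if_nonneg_on_rays\<close>). It is
  derived from Gordan's theorem of the alternative, proved here over the rationals.
\<close>

section \<open>Linearity of the pairing\<close>

lemma pairingQ_add_left: "pairingQ (v + w) u = pairingQ v u + pairingQ w u"
  by (simp add: pairingQ_def scalar_product_def ring_distribs sum.distrib)

lemma pairingQ_add_right: "pairingQ v (u + w) = pairingQ v u + pairingQ v w"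
  by (simp add: pairingQ_def scalar_product_def ring_distribs sum.distrib)

lemma pairingQ_scale_left: "pairingQ (c *s v) u = c * pairingQ v u"
  by (simp add: pairingQ_def scalar_product_def sum_distrib_left mult.assoc)

lemma pairingQ_scale_right: "pairingQ v (c *s u) = c * pairingQ v u"
  by (simp add: pairingQ_def scalar_product_def sum_distrib_left algebra_simps)

lemma pairingQ_diff_left: "pairingQ (v - w) u = pairingQ v u - pairingQ w u"
  by (simp add: pairingQ_def scalar_product_def algebra_simps sum_subtractf)

lemma pairingQ_diff_right: "pairingQ v (u - w) = pairingQ v u - pairingQ v w"
  by (simp add: pairingQ_def scalar_product_def algebra_simps sum_subtractf)

lemma pairingQ_zero_left [simp]: "pairingQ 0 u = 0"
  by (simp add: pairingQ_def scalar_product_def)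

lemma pairingQ_zero_right [simp]: "pairingQ v 0 = 0"
  by (simp add: pairingQ_def scalar_product_def)

lemma pairingQ_sum_left: "pairingQ (\<Sum>i\<in>I. f i) u = (\<Sum>i\<in>I. pairingQ (f i) u)"
  by (induction I rule: infinite_finite_induct) (auto simp: pairingQ_add_left)

lemma pairingQ_axis: "pairingQ v (axis k 1) = v $ k"
  by (simp add: pairingQ_def scalar_product_def axis_def if_distrib cong: if_cong)

lemma pairingQ_self_pos: "v \<noteq> 0 \<Longrightarrow> 0 < pairingQ v v"
proof -
  assume "v \<noteq> 0"
  then obtain k where "v $ k \<noteq> 0"
    by (metis vec_eq_iff zero_index)
  then have "0 < v $ k * v $ k"
    by (auto simp: zero_less_mult_iff)
  then show ?thesis
    unfolding pairingQ_def scalar_product_def by (intro sum_pos2[of _ k]) auto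
qed

lemmas pairingQ_linear = pairingQ_add_left pairingQ_add_right pairingQ_scale_left
  pairingQ_scale_right pairingQ_diff_left pairingQ_diff_right

lemma pairing_add_right: "pairing v (u + w) = pairing v u + pairing v w"
  by (simp add: pairing_def scalar_product_def ring_distribs sum.distrib)

lemma pairing_scale_right: "pairing v (c *s u) = c * pairing v u"
  by (simp add: pairing_def scalar_product_def sum_distrib_left algebra_simps)

lemma to_Q_add: "to_Q (u + w) = to_Q u + to_Q w"
  by (simp add: to_Q_def vec_eq_iff)

lemma to_Q_scale: "to_Q (c *s u) = of_int c *s to_Q u"
  by (simp add: to_Q_def vec_eq_iff)

lemma to_Q_zero [simp]: "to_Q 0 = 0"
  by (simp add: to_Q_def vec_eq_iff)

lemma to_Q_eq_zero_iff [simp]: "to_Q v = 0 \<longleftrightarrow> v = 0"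
  by (simp add: to_Q_def vec_eq_iff)

section \<open>Gordan's theorem\<close>

text \<open>
  Gordan's theorem of the alternative over the rationals, by elimination of one vector
  \<open>a j\<close>. A functional \<open>u\<close> that is positive on the other vectors is either positive on \<open>a j\<close>
  already, or the positive combinations \<open>b i\<close> of \<open>a i\<close> and \<open>a j\<close> that \<open>u\<close> annihilates again
  satisfy the hypothesis. A functional \<open>u'\<close> positive on all \<open>b i\<close> is then corrected
  by a multiple of \<open>u\<close>; positivity on \<open>b i\<close> says precisely that the lower bound that
  \<open>a i\<close> puts on this multiple is compatible with the upper bound that \<open>a j\<close> puts on it.
\<close>

lemma gordan:
  fixes a :: "'i \<Rightarrow> rat^'n"
  assumes "finite I"
    and "\<And>c. (\<forall>i\<in>I. 0 \<le> c i) \<Longrightarrow> (\<Sum>i\<in>I. c i *s a i) = 0 \<Longrightarrow> \<forall>i\<in>I. c i = 0"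
  shows "\<exists>u. \<forall>i\<in>I. 0 < pairingQ (a i) u"
  using assms
proof (induction I arbitrary: a rule: finite_induct)
  case empty
  then show ?case by simp
next
  case (insert j I)
  show ?case
  proof (cases "I = {}")
    case True
    have "a j \<noteq> 0"
      using insert.prems[of "\<lambda>_. 1"] True by auto
    then show ?thesis
      using True pairingQ_self_pos by blast
  next
    case False
    have "\<forall>i\<in>I. c i = 0" if "\<forall>i\<in>I. 0 \<le> c i" "(\<Sum>i\<in>I. c i *s a i) = 0" for c
    proof -
      have "(\<Sum>i\<in>I. (if i = j then 0 else c i) *s a i) = (\<Sum>i\<in>I. c i *s a i)"
        using insert.hyps by (intro sum.cong) auto
      then have "\<forall>i\<in>insert j I. (if i = j then 0 else c i) = 0"
        using that insert.hyps by (intro insert.prems) auto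
      then show ?thesis
        using insert.hyps(2) by (metis insertCI)
    qed
    then obtain u where u: "\<forall>i\<in>I. 0 < pairingQ (a i) u"
      using insert.IH by blast
    show ?thesis
    proof (cases "0 < pairingQ (a j) u")
      case True
      then show ?thesis using u by blast
    next
      case False
      define d where "d = - pairingQ (a j) u"
      have d: "d \<ge> 0" "pairingQ (a j) u = - d"
        using False by (auto simp: d_def)
      define b where "b i = pairingQ (a i) u *s a j + d *s a i" for i
      have "\<forall>i\<in>I. c i = 0" if c: "\<forall>i\<in>I. 0 \<le> c i" "(\<Sum>i\<in>I. c i *s b i) = 0" for c
      proof -
        define s where "s = (\<Sum>i\<in>I. c i * pairingQ (a i) u)"
        \<comment> \<open>The relation among the \<open>a i\<close> obtained by expanding each \<open>b i\<close>.\<close>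
        define c' where "c' i = (if i = j then s else d * c i)" for i
        have s: "s \<ge> 0"
          unfolding s_def using c u by (intro sum_nonneg) (auto intro: less_imp_le)
        have "(\<Sum>i\<in>I. c' i *s a i) = (\<Sum>i\<in>I. (d * c i) *s a i)"
          using insert.hyps by (intro sum.cong) (auto simp: c'_def)
        then have "(\<Sum>i\<in>insert j I. c' i *s a i) = s *s a j + (\<Sum>i\<in>I. (d * c i) *s a i)"
          using insert.hyps by (simp add: c'_def)
        also have "\<dots> = (\<Sum>i\<in>I. c i *s b i)"
          by (simp add: b_def s_def vec.scale_sum_left vec.scale_right_distrib sum.distrib
              mult.commute)
        finally have "\<forall>i\<in>insert j I. c' i = 0"
          using c d s by (intro insert.prems) (auto simp: c'_def)
        then have "c' j = 0"
          by blast
        then have "\<forall>i\<in>I. c i * pairingQ (a i) u = 0"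
          unfolding c'_def s_def using c u insert.hyps
          by (subst sum_nonneg_eq_0_iff[symmetric]) (auto intro: less_imp_le)
        then show ?thesis using u by fastforce
      qed
      then obtain u' where u': "\<forall>i\<in>I. 0 < pairingQ (b i) u'"
        using insert.IH by blast
      \<comment> \<open>The multiple \<open>t\<close> must exceed \<open>M\<close>, and \<open>t * d\<close> must stay below \<open>pairingQ (a j) u'\<close>.\<close>
      define M where "M = Max ((\<lambda>i. - pairingQ (a i) u' / pairingQ (a i) u) ` I)"
      have M: "- pairingQ (a i) u' / pairingQ (a i) u \<le> M" if "i \<in> I" for i
        unfolding M_def using that insert.hyps by simp
      have "M \<in> (\<lambda>i. - pairingQ (a i) u' / pairingQ (a i) u) ` I"
        unfolding M_def using \<open>I \<noteq> {}\<close> insert.hyps by (intro Max_in) auto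
      then obtain k where k: "k \<in> I" "M = - pairingQ (a k) u' / pairingQ (a k) u"
        by blast
      have gap: "M * d < pairingQ (a j) u'"
        using u'[rule_format, OF k(1)] u[rule_format, OF k(1)]
        by (simp add: k(2) b_def pairingQ_linear field_simps)
      \<comment> \<open>The denominator is \<open>d + 1\<close> because \<open>d\<close> may be zero, in which case the upper bound is void.\<close>
      define t where "t = M + (pairingQ (a j) u' - M * d) / (d + 1)"
      have "M < t"
        unfolding t_def using gap d by simp
      have "t * d < pairingQ (a j) u'"
      proof -
        have "pairingQ (a j) u' - t * d = (pairingQ (a j) u' - M * d) / (d + 1)"
          using d unfolding t_def by (simp add: field_simps)
        then show ?thesis
          using gap d by (smt (verit) divide_pos_pos diff_gt_0_iff_gt add_nonneg_pos zero_less_one)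
      qed
      then have "0 < pairingQ (a j) (u' + t *s u)"
        by (simp add: pairingQ_linear d)
      moreover have "0 < pairingQ (a i) (u' + t *s u)" if "i \<in> I" for i
      proof -
        have "- pairingQ (a i) u' / pairingQ (a i) u < t"
          using M[OF that] \<open>M < t\<close> by linarith
        then show ?thesis
          using u that by (simp add: pairingQ_linear field_simps)
      qed
      ultimately show ?thesis by auto
    qed
  qed
qed

text \<open>
  Gordan's theorem in the quotient by the line through \<open>g\<close>. The quotient is realised as the
  coordinate hyperplane \<open>v $ k = 0\<close>, where \<open>g $ k\<close> is nonzero, and a functional on it is pulled
  back along the projection with direction \<open>g\<close>. For a generator \<open>g\<close> of a pointed cone, this provides
  the supporting hyperplane that cuts out the ray of \<open>g\<close>.
\<close>

lemma gordan_modulo_line: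
  fixes a :: "'i \<Rightarrow> rat^'n"
  assumes "finite I" and "g \<noteq> 0"
    and indep: "\<And>c t. (\<forall>i\<in>I. 0 \<le> c i) \<Longrightarrow> (\<Sum>i\<in>I. c i *s a i) = t *s g \<Longrightarrow> \<forall>i\<in>I. c i = 0"
  shows "\<exists>u. pairingQ g u = 0 \<and> (\<forall>i\<in>I. 0 < pairingQ (a i) u)"
proof -
  obtain k where k: "g $ k \<noteq> 0"
    using \<open>g \<noteq> 0\<close> by (metis vec_eq_iff zero_index)
  define b where "b i = a i - (a i $ k / g $ k) *s g" for i
  have "\<forall>i\<in>I. c i = 0" if "\<forall>i\<in>I. 0 \<le> c i" "(\<Sum>i\<in>I. c i *s b i) = 0" for c
  proof -
    have "(\<Sum>i\<in>I. c i *s b i)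
        = (\<Sum>i\<in>I. c i *s a i) - (\<Sum>i\<in>I. c i * (a i $ k / g $ k)) *s g"
      by (simp add: b_def vec.scale_right_diff_distrib vec.scale_sum_left sum_subtractf)
    then have "(\<Sum>i\<in>I. c i *s a i) = (\<Sum>i\<in>I. c i * (a i $ k / g $ k)) *s g"
      by (simp add: that(2))
    then show ?thesis
      by (rule indep[OF that(1)])
  qed
  then obtain u where u: "\<forall>i\<in>I. 0 < pairingQ (b i) u"
    using gordan[OF \<open>finite I\<close>, of b] by blast
  \<comment> \<open>The pullback of \<open>u\<close> along the projection that maps \<open>a i\<close> to \<open>b i\<close>.\<close>
  define w where "w = u - (pairingQ g u / g $ k) *s axis k 1"
  have "pairingQ (a i) w = pairingQ (b i) u" for i
    by (simp add: w_def b_def pairingQ_linear pairingQ_axis)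
  moreover have "pairingQ g w = 0"
    using k by (simp add: w_def pairingQ_linear pairingQ_axis)
  ultimately show ?thesis using u by auto
qed

section \<open>Finitely generated cones\<close>

lemma cone_gen_finite:
  assumes "finite G"
  shows "cone_gen G = {\<Sum>v\<in>G. c v *s v | c. \<forall>v\<in>G. 0 \<le> c v}"
proof (intro equalityI subsetI)
  fix x assume "x \<in> cone_gen G"
  then obtain F c where F: "finite F" "F \<subseteq> G" "\<forall>v\<in>F. 0 \<le> c v" "x = (\<Sum>v\<in>F. c v *s v)"
    unfolding cone_gen_def by blast
  have "x = (\<Sum>v\<in>G. (if v \<in> F then c v else 0) *s v)"
    unfolding F(4) using F assms by (intro sum.mono_neutral_cong_left) auto
  then show "x \<in> {\<Sum>v\<in>G. c v *s v | c. \<forall>v\<in>G. 0 \<le> c v}"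
    using F by (auto intro!: exI[of _ "\<lambda>v. if v \<in> F then c v else 0"])
next
  fix x assume "x \<in> {\<Sum>v\<in>G. c v *s v | c. \<forall>v\<in>G. 0 \<le> c v}"
  then show "x \<in> cone_gen G"
    unfolding cone_gen_def using assms by blast
qed

lemma cone_gen_mono: "G \<subseteq> H \<Longrightarrow> cone_gen G \<subseteq> cone_gen H"
  unfolding cone_gen_def by blast

lemma cone_gen_superset: "G \<subseteq> cone_gen G"
proof
  fix g assume "g \<in> G"
  then show "g \<in> cone_gen G"
    unfolding cone_gen_def by (auto intro!: exI[of _ "{g}"] exI[of _ "\<lambda>_. 1"])
qed

lemma cone_gen_zero: "0 \<in> cone_gen G"
  unfolding cone_gen_def by (auto intro!: exI[of _ "{}"])

lemma cone_gen_add: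
  assumes "finite G" "x \<in> cone_gen G" "y \<in> cone_gen G"
  shows "x + y \<in> cone_gen G"
proof -
  obtain c d where "\<forall>v\<in>G. 0 \<le> c v" "x = (\<Sum>v\<in>G. c v *s v)"
      "\<forall>v\<in>G. 0 \<le> d v" "y = (\<Sum>v\<in>G. d v *s v)"
    using assms unfolding cone_gen_finite[OF assms(1)] by blast
  then show ?thesis
    unfolding cone_gen_finite[OF assms(1)]
    by (auto simp: vec.scale_left_distrib sum.distrib intro!: exI[of _ "\<lambda>v. c v + d v"])
qed

lemma cone_gen_scale:
  assumes "x \<in> cone_gen G" "0 \<le> (r::rat)"
  shows "r *s x \<in> cone_gen G"
proof -
  obtain F c where F: "finite F" "F \<subseteq> G" "\<forall>v\<in>F. 0 \<le> c v" "x = (\<Sum>v\<in>F. c v *s v)"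
    using assms unfolding cone_gen_def by blast
  have "r *s x = (\<Sum>v\<in>F. (r * c v) *s v)"
    by (simp add: F(4) vec.scale_sum_right)
  moreover have "\<forall>v\<in>F. 0 \<le> r * c v"
    using F assms by simp
  ultimately show ?thesis
    unfolding cone_gen_def using F(1,2) by (intro CollectI exI[of _ F] exI[of _ "\<lambda>v. r * c v"]) simp
qed

lemma cone_gen_sum:
  assumes "finite G" "\<And>i. i \<in> I \<Longrightarrow> f i \<in> cone_gen G"
  shows "(\<Sum>i\<in>I. f i) \<in> cone_gen G"
  using assms(2)
  by (induction I rule: infinite_finite_induct) (auto simp: cone_gen_zero cone_gen_add[OF assms(1)])

lemma cone_gen_subset:
  assumes "finite H" "G \<subseteq> cone_gen H"
  shows "cone_gen G \<subseteq> cone_gen H"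
proof
  fix x assume "x \<in> cone_gen G"
  then obtain F c where F: "finite F" "F \<subseteq> G" "\<forall>v\<in>F. 0 \<le> c v" "x = (\<Sum>v\<in>F. c v *s v)"
    unfolding cone_gen_def by blast
  show "x \<in> cone_gen H"
    unfolding F(4) using F assms by (intro cone_gen_sum cone_gen_scale) auto
qed

lemma dual_cone_gen:
  "w \<in> dual_cone (cone_gen G) \<longleftrightarrow> (\<forall>g\<in>G. 0 \<le> pairingQ g w)"
proof
  show "\<forall>g\<in>G. 0 \<le> pairingQ g w" if "w \<in> dual_cone (cone_gen G)"
    using that cone_gen_superset unfolding dual_cone_def by blast
next
  assume "\<forall>g\<in>G. 0 \<le> pairingQ g w"
  then show "w \<in> dual_cone (cone_gen G)"
    by (auto simp: dual_cone_def cone_gen_def pairingQ_sum_left pairingQ_scale_left subset_iff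
        intro!: sum_nonneg mult_nonneg_nonneg)
qed

lemma perp_cone_gen:
  "w \<in> perp (cone_gen G) \<longleftrightarrow> (\<forall>g\<in>G. pairingQ g w = 0)"
proof
  show "\<forall>g\<in>G. pairingQ g w = 0" if "w \<in> perp (cone_gen G)"
    using that cone_gen_superset unfolding perp_def by blast
next
  assume "\<forall>g\<in>G. pairingQ g w = 0"
  then show "w \<in> perp (cone_gen G)"
    by (auto simp: perp_def cone_gen_def pairingQ_sum_left pairingQ_scale_left subset_iff
        intro!: sum.neutral)
qed

section \<open>Primitive vectors\<close>

lemma integral_multiple:
  fixes v :: "rat^'n::finite"
  obtains z and d :: int where "d > 0" "to_Q z = of_int d *s v"
proof -
  define den where "den i = snd (quotient_of (v $ i))" for i
  define d where "d = (\<Prod>i\<in>UNIV. den i)"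
  have den: "den i > 0" "of_int (den i) * v $ i = of_int (fst (quotient_of (v $ i)))" for i
  proof -
    show "den i > 0"
      unfolding den_def by (metis quotient_of_denom_pos surjective_pairing)
    then show "of_int (den i) * v $ i = of_int (fst (quotient_of (v $ i)))"
      unfolding den_def using quotient_of_div[of "v $ i"]
      by (metis nonzero_eq_divide_eq mult.commute of_int_eq_0_iff order_less_irrefl prod.collapse)
  qed
  have "\<exists>k::int. of_int d * v $ i = of_int k" for i
  proof -
    have "d = (\<Prod>j\<in>UNIV - {i}. den j) * den i"
      unfolding d_def by (simp add: prod.remove[of UNIV i])
    then have "of_int d * v $ i
        = of_int ((\<Prod>j\<in>UNIV - {i}. den j) * fst (quotient_of (v $ i)))"
      using den(2)[of i] by (simp add: mult.assoc)
    then show ?thesis by blast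
  qed
  then obtain k where "\<And>i. of_int d * v $ i = of_int (k i :: int)"
    by metis
  then have "to_Q (\<chi> i. k i) = of_int d *s v"
    by (simp add: to_Q_def vec_eq_iff)
  moreover have "d > 0"
    unfolding d_def by (intro prod_pos) (simp add: den)
  ultimately show thesis using that by blast
qed

lemma primitive_multiple:
  fixes v :: "rat^'n::finite"
  assumes "v \<noteq> 0"
  obtains q and r :: rat where "r > 0" "primitive q" "to_Q q = r *s v"
proof -
  obtain z d where z: "d > 0" "to_Q z = of_int d *s v"
    using integral_multiple by blast
  \<comment> \<open>Dividing by the content of the coordinates makes the vector primitive.\<close>
  define g where "g = (GCD i. z $ i)"
  have "z \<noteq> 0"
    using z assms by (metis to_Q_zero vector_mul_eq_0 of_int_eq_0_iff less_irrefl)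
  then have "g \<noteq> 0"
    by (auto simp: g_def vec_eq_iff)
  then have "g > 0"
    by (simp add: g_def order_less_le)
  define q where "q = (\<chi> i. z $ i div g)"
  have zq: "z = g *s q"
    by (auto simp: q_def g_def vec_eq_iff)
  have "\<bar>k\<bar> = 1" if "q = k *s q'" for k q'
  proof -
    have "g * k dvd z $ i" for i
      by (simp add: zq that)
    then have "g * k dvd (GCD i. z $ i)"
      by (intro Gcd_greatest) auto
    then have "g * k dvd g * 1"
      by (simp flip: g_def)
    then show ?thesis
      using \<open>g \<noteq> 0\<close> by (subst (asm) dvd_times_left_cancel_iff) simp_all
  qed
  moreover have "q \<noteq> 0"
    using zq \<open>z \<noteq> 0\<close> by auto
  ultimately have "primitive q"
    unfolding primitive_def by blast
  moreover have "to_Q q = (of_int d / of_int g) *s v"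
  proof -
    have "of_int d *s v = of_int g *s to_Q q"
      using z zq to_Q_scale by metis
    then have "(1 / of_int g) *s (of_int d *s v) = (1 / of_int g) *s (of_int g *s to_Q q)"
      by simp
    then show ?thesis
      using \<open>g > 0\<close> by (simp add: vector_smult_assoc)
  qed
  moreover have "of_int d / of_int g > (0::rat)"
    using z(1) \<open>g > 0\<close> by simp
  ultimately show thesis using that by blast
qed

section \<open>Generation of a pointed cone by its rays\<close>

text \<open>
  A pointed polyhedral cone is generated by its rays; stated dually, which is the form in which
  Demazure roots use it. In a generating set of least cardinality, no generator \<open>g\<close> is
  redundant, and together with pointedness this says that the other generators \<open>H\<close> have no nontrivial
  nonnegative relation modulo the line of \<open>g\<close>. Hence some functional vanishes on \<open>g\<close> and is positive
  on \<open>H\<close>, and the face that it cuts out is the ray of \<open>g\<close>.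
\<close>

lemma dual_cone_if_nonneg_on_rays:
  fixes \<sigma> :: "(rat^'n::finite) set"
  assumes "polyhedral_cone \<sigma>" and "strongly_convex \<sigma>"
    and nonneg: "\<And>q. q \<in> ray_vectors \<sigma> \<Longrightarrow> 0 \<le> pairingQ (to_Q q) w"
  shows "w \<in> dual_cone \<sigma>"
proof -
  obtain G where G: "finite G" "\<sigma> = cone_gen G"
    and least: "\<And>H. finite H \<Longrightarrow> \<sigma> = cone_gen H \<Longrightarrow> card G \<le> card H"
  proof -
    obtain G0 where "finite G0 \<and> \<sigma> = cone_gen G0"
      using assms(1) by (auto simp: polyhedral_cone_def)
    from ex_has_least_nat[of "\<lambda>G. finite G \<and> \<sigma> = cone_gen G", OF this, of card]
    show thesis
      using that by metis
  qed
  have irredundant: "g \<notin> cone_gen (G - {g})" if "g \<in> G" for g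
  proof
    assume "g \<in> cone_gen (G - {g})"
    then have "G \<subseteq> cone_gen (G - {g})"
      using cone_gen_superset[of "G - {g}"] by blast
    then have "\<sigma> = cone_gen (G - {g})"
      using G cone_gen_subset[of "G - {g}" G] cone_gen_mono[of "G - {g}" G] by blast
    then show False
      using least[of "G - {g}"] G(1) that card_Diff1_less[of G g] by simp
  qed
  then have nonzero: "0 \<notin> G"
    using cone_gen_zero by blast
  have "0 \<le> pairingQ g w" if g: "g \<in> G" for g
  proof -
    define H where "H = G - {g}"
    have H: "finite H" "cone_gen H \<subseteq> \<sigma>" "G = insert g H" "g \<notin> H"
      using G g cone_gen_mono[of H G] by (auto simp: H_def)
    have "g \<noteq> 0" using g nonzero by blast
    have "g \<in> \<sigma>" using g G cone_gen_superset by blast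
    have "\<forall>h\<in>H. c h = 0" if c: "\<forall>h\<in>H. 0 \<le> c h" "(\<Sum>h\<in>H. c h *s h) = t *s g" for c t
    proof (rule ccontr)
      assume "\<not> (\<forall>h\<in>H. c h = 0)"
      then obtain h where h: "h \<in> H" "c h \<noteq> 0" by blast
      have in_cone: "(\<Sum>h\<in>F. c h *s h) \<in> cone_gen H" if "F \<subseteq> H" for F
        using that c H cone_gen_superset[of H]
        by (intro cone_gen_sum cone_gen_scale) auto
      \<comment> \<open>Otherwise \<open>g\<close> would be a nonnegative combination of the other generators.\<close>
      have "t \<le> 0"
      proof (rule ccontr)
        assume "\<not> t \<le> 0"
        then have "g = (1 / t) *s (\<Sum>h\<in>H. c h *s h)"
          by (simp add: c(2) vector_smult_assoc)
        also have "\<dots> \<in> cone_gen H"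
          using in_cone[of H] \<open>\<not> t \<le> 0\<close> by (intro cone_gen_scale) auto
        finally show False
          using irredundant[OF g] by (simp add: H_def)
      qed
      have "t *s g \<in> \<sigma>"
        using in_cone[of H] H c(2) by auto
      moreover have "- (t *s g) \<in> \<sigma>"
        using cone_gen_scale[of g G "- t"] \<open>g \<in> \<sigma>\<close> \<open>t \<le> 0\<close> G(2) by simp
      ultimately have "t *s g = 0"
        using assms(2) unfolding strongly_convex_def by blast
      then have "(\<Sum>h\<in>H. c h *s h) = 0"
        by (simp only: c(2))
      \<comment> \<open>In a pointed cone a vanishing sum of elements has only zero summands.\<close>
      then have "c h *s h + (\<Sum>h\<in>H - {h}. c h *s h) = 0"
        by (simp only: sum.remove[OF H(1) h(1)])
      then have "- (c h *s h) = (\<Sum>h\<in>H - {h}. c h *s h)"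
        by (rule minus_unique)
      then have "- (c h *s h) \<in> \<sigma>"
        using in_cone[of "H - {h}"] H(2) by auto
      moreover have "c h *s h \<in> \<sigma>"
        using in_cone[of "{h}"] H(2) h by auto
      ultimately have "c h *s h = 0"
        using assms(2) unfolding strongly_convex_def by blast
      then show False
        using h H(3) nonzero by auto
    qed
    then obtain u where u: "pairingQ g u = 0" "\<forall>h\<in>H. 0 < pairingQ h u"
      using gordan_modulo_line[OF H(1) \<open>g \<noteq> 0\<close>, of "\<lambda>h. h"] by blast
    have "u \<in> dual_cone \<sigma>"
      unfolding G(2) dual_cone_gen using u H(3) by (auto intro: less_imp_le)
    define R where "R = {v \<in> \<sigma>. pairingQ v u = 0}"
    have "cone_face R \<sigma>"
      unfolding cone_face_def R_def using \<open>u \<in> dual_cone \<sigma>\<close> by blast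
    have "v \<in> vec.span {g}" if "v \<in> R" for v
    proof -
      have "v \<in> cone_gen G" and v0: "pairingQ v u = 0"
        using that G(2) by (auto simp: R_def)
      then obtain c where c: "v = (\<Sum>x\<in>G. c x *s x)" "\<forall>x\<in>G. 0 \<le> c x"
        unfolding cone_gen_finite[OF G(1)] by blast
      have "(\<Sum>h\<in>H. c h * pairingQ h u) = 0"
        using v0 u(1) H
        by (simp add: c(1) pairingQ_add_left pairingQ_sum_left pairingQ_scale_left)
      then have "\<forall>h\<in>H. c h * pairingQ h u = 0"
        using H c u by (subst sum_nonneg_eq_0_iff[symmetric]) (auto intro: less_imp_le)
      then have "\<forall>h\<in>H. c h = 0"
        using u by fastforce
      then have "v = c g *s g"
        using H by (simp add: c(1))
      then show ?thesis
        by (simp add: vec.span_base vec.span_scale)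
    qed
    then have "vec.dim R = 1"
      using \<open>g \<noteq> 0\<close> \<open>g \<in> \<sigma>\<close> u(1)
      by (intro vec.dim_unique[of "{g}"]) (auto simp: R_def)
    obtain q r where q: "r > 0" "primitive q" "to_Q q = r *s g"
      using primitive_multiple[OF \<open>g \<noteq> 0\<close>] by blast
    have "to_Q q \<in> R"
      using cone_gen_scale[of g G r] \<open>g \<in> \<sigma>\<close> q u(1) G(2) by (simp add: R_def pairingQ_scale_left)
    then have "q \<in> ray_vectors \<sigma>"
      unfolding ray_vectors_def cone_ray_def primitive_on_def
      using \<open>cone_face R \<sigma>\<close> \<open>vec.dim R = 1\<close> q(2) by blast
    then show "0 \<le> pairingQ g w"
      using nonneg[of q] q by (simp add: pairingQ_scale_left zero_le_mult_iff)
  qed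
  then show ?thesis
    unfolding G(2) dual_cone_gen by blast
qed

section \<open>Points and characters\<close>

lemma poly_mapping_eq_sum_single:
  "f = (\<Sum>u\<in>Poly_Mapping.keys f. Poly_Mapping.single u (Poly_Mapping.lookup f u))"
  by (rule poly_mapping_eqI)
    (simp add: lookup_sum lookup_single when_def in_keys_iff)

lemma dual_semigroup_iff:
  "u \<in> dual_semigroup \<sigma> \<longleftrightarrow> (\<forall>v\<in>\<sigma>. 0 \<le> pairingQ v (to_Q u))"
  by (simp add: dual_semigroup_def dual_cone_def)

lemma dual_semigroup_zero [simp]: "0 \<in> dual_semigroup \<sigma>"
  by (simp add: dual_semigroup_iff)

lemma dual_semigroup_add:
  "u \<in> dual_semigroup \<sigma> \<Longrightarrow> w \<in> dual_semigroup \<sigma> \<Longrightarrow> u + w \<in> dual_semigroup \<sigma>"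
  by (simp add: dual_semigroup_iff to_Q_add pairingQ_add_right)

lemma coord_ring_single:
  "u \<in> dual_semigroup \<sigma> \<Longrightarrow> Poly_Mapping.single u c \<in> coord_ring \<sigma>"
  by (simp add: coord_ring_def)

lemma coord_ring_add: "f \<in> coord_ring \<sigma> \<Longrightarrow> g \<in> coord_ring \<sigma> \<Longrightarrow> f + g \<in> coord_ring \<sigma>"
  using keys_add[of f g] by (auto simp: coord_ring_def)

lemma coord_ring_mult: "f \<in> coord_ring \<sigma> \<Longrightarrow> g \<in> coord_ring \<sigma> \<Longrightarrow> f * g \<in> coord_ring \<sigma>"
  using keys_mult[of f g] by (fastforce simp: coord_ring_def intro: dual_semigroup_add)

lemma toric_point_expand:
  fixes x :: "('k::field, 'n::finite) point"
  assumes x: "x \<in> toric_variety \<sigma>" and f: "f \<in> coord_ring \<sigma>"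
  shows "x f = (\<Sum>u\<in>Poly_Mapping.keys f. Poly_Mapping.lookup f u * x (chr u))"
proof -
  have single: "x (Poly_Mapping.single u c) = c * x (chr u)" if "u \<in> dual_semigroup \<sigma>" for u c
  proof -
    have "Poly_Mapping.single u c = Poly_Mapping.single 0 c * chr u"
      by (simp add: chr_def mult_single)
    then show ?thesis
      using x that by (simp add: toric_variety_def coord_ring_single)
  qed
  have zero: "x 0 = 0"
    using x by (metis (mono_tags, lifting) mem_Collect_eq single_zero toric_variety_def)
  have "(\<Sum>u\<in>A. Poly_Mapping.single u (Poly_Mapping.lookup f u)) \<in> coord_ring \<sigma> \<and>
      x (\<Sum>u\<in>A. Poly_Mapping.single u (Poly_Mapping.lookup f u))
        = (\<Sum>u\<in>A. Poly_Mapping.lookup f u * x (chr u))"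
    if "finite A" "A \<subseteq> dual_semigroup \<sigma>" for A
    using that
  proof (induction A rule: finite_induct)
    case empty
    then show ?case by (simp add: zero coord_ring_def)
  next
    case (insert u A)
    then show ?case
      using x by (simp add: toric_variety_def coord_ring_single coord_ring_add single)
  qed
  from this[of "Poly_Mapping.keys f"] show ?thesis
    using f poly_mapping_eq_sum_single[of f] by (simp add: coord_ring_def)
qed

definition linear_extension :: "('a \<Rightarrow> 'k) \<Rightarrow> ('a \<Rightarrow>\<^sub>0 'k::field) \<Rightarrow> 'k" where
  "linear_extension \<phi> f = (\<Sum>u\<in>Poly_Mapping.keys f. Poly_Mapping.lookup f u * \<phi> u)"

lemma linear_extension_superset:
  assumes "finite A" "Poly_Mapping.keys f \<subseteq> A"
  shows "linear_extension \<phi> f = (\<Sum>u\<in>A. Poly_Mapping.lookup f u * \<phi> u)"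
  unfolding linear_extension_def using assms
  by (intro sum.mono_neutral_left) (auto simp: in_keys_iff)

lemma linear_extension_single: "linear_extension \<phi> (Poly_Mapping.single u c) = c * \<phi> u"
  by (subst linear_extension_superset[of "{u}"]) auto

lemma linear_extension_zero [simp]: "linear_extension \<phi> 0 = 0"
  by (simp add: linear_extension_def)

lemma linear_extension_add:
  "linear_extension \<phi> (f + g) = linear_extension \<phi> f + linear_extension \<phi> g"
proof -
  let ?A = "Poly_Mapping.keys f \<union> Poly_Mapping.keys g"
  have "Poly_Mapping.keys (f + g) \<subseteq> ?A" by (rule keys_add)
  then show ?thesis
    by (simp add: linear_extension_superset[of ?A] lookup_add ring_distribs sum.distrib)
qed

lemma linear_extension_sum:
  "linear_extension \<phi> (\<Sum>a\<in>A. f a) = (\<Sum>a\<in>A. linear_extension \<phi> (f a))"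
  by (induction A rule: infinite_finite_induct) (auto simp: linear_extension_add)

lemma linear_extension_mult:
  assumes "\<And>u w. u \<in> Poly_Mapping.keys f \<Longrightarrow> w \<in> Poly_Mapping.keys g \<Longrightarrow> \<phi> (u + w) = \<phi> u * \<phi> w"
  shows "linear_extension \<phi> (f * g) = linear_extension \<phi> f * linear_extension \<phi> g"
proof -
  have "f * g = (\<Sum>u\<in>Poly_Mapping.keys f. \<Sum>w\<in>Poly_Mapping.keys g.
      Poly_Mapping.single (u + w) (Poly_Mapping.lookup f u * Poly_Mapping.lookup g w))"
    by (subst poly_mapping_eq_sum_single[of f], subst poly_mapping_eq_sum_single[of g])
      (simp add: sum_product mult_single)
  then have "linear_extension \<phi> (f * g) = (\<Sum>u\<in>Poly_Mapping.keys f. \<Sum>w\<in>Poly_Mapping.keys g.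
      Poly_Mapping.lookup f u * Poly_Mapping.lookup g w * (\<phi> u * \<phi> w))"
    using assms by (simp add: linear_extension_sum linear_extension_single)
  then show ?thesis
    by (simp add: linear_extension_def sum_product mult_ac)
qed

text \<open>
  The half of the correspondence between points of \<open>toric_variety \<sigma>\<close> and semigroup homomorphisms
  that constructs points. It is needed because a distinguished point is
  given as a linear functional, so that its multiplicativity has to be proved.
\<close>

lemma toric_point_of_character:
  fixes \<phi> :: "int^'n::finite \<Rightarrow> 'k::field"
  assumes "\<phi> 0 = 1"
    and "\<And>u w. u \<in> dual_semigroup \<sigma> \<Longrightarrow> w \<in> dual_semigroup \<sigma> \<Longrightarrow> \<phi> (u + w) = \<phi> u * \<phi> w"
  shows "restrict (linear_extension \<phi>) (coord_ring \<sigma>) \<in> toric_variety \<sigma>"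
proof -
  have "linear_extension \<phi> (f * g) = linear_extension \<phi> f * linear_extension \<phi> g"
    if "f \<in> coord_ring \<sigma>" "g \<in> coord_ring \<sigma>" for f g
    using that assms(2) unfolding coord_ring_def by (intro linear_extension_mult) blast
  then show ?thesis
    by (simp add: toric_variety_def coord_ring_single coord_ring_add coord_ring_mult
        linear_extension_single linear_extension_add assms(1))
qed

lemma toric_variety_eqI:
  fixes x y :: "('k::field, 'n::finite) point"
  assumes "x \<in> toric_variety \<sigma>" "y \<in> toric_variety \<sigma>"
    and "\<And>u. u \<in> dual_semigroup \<sigma> \<Longrightarrow> x (chr u) = y (chr u)"
  shows "x = y"
proof (rule extensionalityI)
  show "x \<in> extensional (coord_ring \<sigma>)" "y \<in> extensional (coord_ring \<sigma>)"
    using assms by (auto simp: toric_variety_def)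
  fix f :: "int^'n \<Rightarrow>\<^sub>0 'k" assume f: "f \<in> coord_ring \<sigma>"
  then have "u \<in> dual_semigroup \<sigma>" if "u \<in> Poly_Mapping.keys f" for u
    using that by (auto simp: coord_ring_def)
  then show "x f = y f"
    by (simp add: toric_point_expand[OF assms(1) f] toric_point_expand[OF assms(2) f] assms(3))
qed

section \<open>Idempotency on characters\<close>

lemma tensor_eval_scale:
  "tensor_eval x y (Poly_Mapping.single 0 c * g) = c * tensor_eval x y g"
proof -
  have "Poly_Mapping.single 0 c * g
      = (\<Sum>k\<in>Poly_Mapping.keys g. Poly_Mapping.single k (c * Poly_Mapping.lookup g k))"
    by (subst poly_mapping_eq_sum_single[of g]) (simp add: sum_distrib_left mult_single)
  moreover have "tensor_eval x y (Poly_Mapping.single k d) = d * (x (chr (fst k)) * y (chr (snd k)))"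
    for k d
    by (cases k) (simp add: tensor_eval_single)
  ultimately show ?thesis
    unfolding tensor_eval_def[of x y g]
    by (simp add: tensor_eval_sum sum_distrib_left case_prod_unfold mult.assoc)
qed

lemma point_mult_expand:
  fixes x y :: "('k::field, 'n::finite) point"
  assumes f: "f \<in> coord_ring \<sigma>"
  shows "point_mult \<sigma> p e1 e2 x y f
    = (\<Sum>u\<in>Poly_Mapping.keys f. Poly_Mapping.lookup f u * point_mult \<sigma> p e1 e2 x y (chr u))"
proof -
  have "point_mult \<sigma> p e1 e2 x y (chr u) = tensor_eval x y (comult_chr p e1 e2 u)"
    if "u \<in> Poly_Mapping.keys f" for u
  proof -
    have "comult p e1 e2 (chr u :: _ \<Rightarrow>\<^sub>0 'k) = comult_chr p e1 e2 u"
      by (simp add: comult_def) (simp add: chr_def)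
    then show ?thesis
      using that f by (auto simp: point_mult_def coord_ring_def chr_def)
  qed
  then show ?thesis
    using f by (simp add: point_mult_def comult_def tensor_eval_sum tensor_eval_scale)
qed

text \<open>
  Both sides of \<open>x * x = x\<close> are linear on the coordinate ring, so idempotency is a system of
  equations indexed by the characters. Every case of the theorem is an analysis of this system.
\<close>

lemma idempotent_iff:
  fixes x :: "('k::field, 'n::finite) point"
  assumes "x \<in> toric_variety \<sigma>"
  shows "x \<in> idempotents \<sigma> p e1 e2 \<longleftrightarrow>
    (\<forall>u\<in>dual_semigroup \<sigma>. point_mult \<sigma> p e1 e2 x x (chr u) = x (chr u))"
proof
  show "\<forall>u\<in>dual_semigroup \<sigma>. point_mult \<sigma> p e1 e2 x x (chr u) = x (chr u)"
    if "x \<in> idempotents \<sigma> p e1 e2"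
    using that by (simp add: idempotents_def)
next
  assume *: "\<forall>u\<in>dual_semigroup \<sigma>. point_mult \<sigma> p e1 e2 x x (chr u) = x (chr u)"
  have "point_mult \<sigma> p e1 e2 x x = x"
  proof (rule extensionalityI)
    show "point_mult \<sigma> p e1 e2 x x \<in> extensional (coord_ring \<sigma>)"
      by (simp add: point_mult_def)
    show "x \<in> extensional (coord_ring \<sigma>)"
      using assms by (simp add: toric_variety_def)
    fix f :: "int^'n \<Rightarrow>\<^sub>0 'k" assume f: "f \<in> coord_ring \<sigma>"
    then have "u \<in> dual_semigroup \<sigma>" if "u \<in> Poly_Mapping.keys f" for u
      using that by (auto simp: coord_ring_def)
    then show "point_mult \<sigma> p e1 e2 x x f = x f"
      using * by (simp add: point_mult_expand[OF f] toric_point_expand[OF assms f])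
  qed
  then show "x \<in> idempotents \<sigma> p e1 e2"
    using assms by (simp add: idempotents_def)
qed

text \<open>
  Exchanging the two roots gives the opposite monoid. So the two roots
  play symmetric roles in every statement about idempotents.
\<close>

lemma point_mult_opposite:
  assumes "u \<in> dual_semigroup \<sigma>"
  shows "point_mult \<sigma> p e2 e1 x y (chr u) = point_mult \<sigma> p e1 e2 y x (chr u)"
  unfolding point_mult_chr[OF assms]
  by (rule sum.reindex_bij_witness[of _ "\<lambda>i. nat (pairing p u) - i" "\<lambda>i. nat (pairing p u) - i"])
    (simp_all add: mult_ac flip: binomial_symmetric)

lemma idempotents_opposite: "idempotents \<sigma> p e2 e1 = idempotents \<sigma> p e1 e2"
proof -
  have "x \<in> idempotents \<sigma> p e2 e1 \<longleftrightarrow> x \<in> idempotents \<sigma> p e1 e2" if "x \<in> toric_variety \<sigma>" for x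
    by (simp add: idempotent_iff[OF that] point_mult_opposite)
  then show ?thesis
    by (auto simp: idempotents_def)
qed

section \<open>Faces and orbits\<close>

lemma perp_iff: "w \<in> perp \<gamma> \<longleftrightarrow> (\<forall>v\<in>\<gamma>. pairingQ v w = 0)"
  by (simp add: perp_def)

lemma perp_translate_iff:
  assumes "to_Q e \<in> perp \<gamma>"
  shows "to_Q (u + k *s e) \<in> perp \<gamma> \<longleftrightarrow> to_Q u \<in> perp \<gamma>"
  using assms by (simp add: perp_iff to_Q_add to_Q_scale pairingQ_linear)

text \<open>
  \<open>perp \<gamma>\<close> is a linear subspace, so a line with direction outside of it meets it at most once. This
  is what kills the middle terms of the binomial expansion on the orbit of \<open>\<gamma>\<close>.
\<close>

lemma perp_translate_out:
  assumes "to_Q u \<in> perp \<gamma>" "to_Q e \<notin> perp \<gamma>" "k \<noteq> 0"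
  shows "to_Q (u + k *s e) \<notin> perp \<gamma>"
  using assms by (auto simp: perp_iff to_Q_add to_Q_scale pairingQ_linear)

text \<open>
  Both \<open>u\<close> and \<open>w\<close> are nonnegative on \<open>\<gamma>\<close>, so their sum vanishes there only if
  each of them does. This makes the indicator function of \<open>perp \<gamma>\<close> multiplicative on the
  dual semigroup.
\<close>

lemma face_perp_add_iff:
  assumes "cone_face \<gamma> \<sigma>" "u \<in> dual_semigroup \<sigma>" "w \<in> dual_semigroup \<sigma>"
  shows "to_Q (u + w) \<in> perp \<gamma> \<longleftrightarrow> to_Q u \<in> perp \<gamma> \<and> to_Q w \<in> perp \<gamma>"
proof -
  have "0 \<le> pairingQ v (to_Q u)" "0 \<le> pairingQ v (to_Q w)" if "v \<in> \<gamma>" for v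
    using assms that by (auto simp: cone_face_def dual_semigroup_iff)
  then show ?thesis
    by (auto simp: perp_iff to_Q_add pairingQ_linear add_nonneg_eq_0_iff)
qed

lemma distinguished_point_in_orbit:
  fixes \<sigma> \<gamma> :: "(rat^'n::finite) set"
  assumes "cone_face \<gamma> \<sigma>"
  shows "(distinguished_point \<sigma> \<gamma> :: ('k::field, 'n) point) \<in> torus_orbit \<sigma> \<gamma>"
proof -
  define \<phi> :: "int^'n \<Rightarrow> 'k" where "\<phi> u = (if to_Q u \<in> perp \<gamma> then 1 else 0)" for u
  have "distinguished_point \<sigma> \<gamma> = restrict (linear_extension \<phi>) (coord_ring \<sigma>)"
    unfolding distinguished_point_def
    by (intro restrict_ext) (auto simp: linear_extension_def \<phi>_def intro!: sum.cong)
  also have "\<dots> \<in> toric_variety \<sigma>"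
    by (rule toric_point_of_character)
      (simp_all add: \<phi>_def perp_iff face_perp_add_iff[OF assms, unfolded perp_iff])
  finally show ?thesis
    by (simp add: torus_orbit_def chr_distinguished_point)
qed

lemma orbit_chr_eq_zero_iff:
  "x \<in> torus_orbit \<sigma> \<gamma> \<Longrightarrow> u \<in> dual_semigroup \<sigma> \<Longrightarrow> x (chr u) = 0 \<longleftrightarrow> to_Q u \<notin> perp \<gamma>"
  by (auto simp: torus_orbit_def)

section \<open>Idempotents of a monoid of corank one\<close>

locale corank_one_monoid =
  fixes \<sigma> \<rho> :: "(rat^'n::finite) set" and p e1 e2 :: "int^'n"
  assumes polyhedral: "polyhedral_cone \<sigma>" and pointed: "strongly_convex \<sigma>"
    and ray: "cone_ray \<rho> \<sigma>" and primitive: "primitive_on p \<rho>"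
    and root1: "demazure_root \<sigma> p e1" and root2: "demazure_root \<sigma> p e2"
begin

lemma opposite: "corank_one_monoid \<sigma> \<rho> p e2 e1"
  by unfold_locales (fact polyhedral pointed ray primitive root1 root2)+

lemma primitive_in_ray: "to_Q p \<in> \<rho>" and primitive_nonzero: "p \<noteq> 0"
  using primitive by (auto simp: primitive_on_def primitive_def)

lemma ray_subset: "\<rho> \<subseteq> \<sigma>"
  using ray by (auto simp: cone_ray_def cone_face_def)

lemma ray_multiple:
  assumes "v \<in> \<rho>"
  obtains c where "v = c *s to_Q p"
proof -
  have "\<rho> \<subseteq> vec.span {to_Q p}"
    using ray primitive_in_ray primitive_nonzero
    by (intro vec.card_ge_dim_independent) (auto simp: cone_ray_def)
  then show thesis
    using assms that by (auto simp: vec.span_singleton)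
qed

lemma pairing_nonneg: "u \<in> dual_semigroup \<sigma> \<Longrightarrow> 0 \<le> pairing p u"
  using primitive_in_ray ray_subset
  by (metis dual_semigroup_iff of_int_0_le_iff pairingQ_to_Q subsetD)

text \<open>
  All characters in the expansion of the comultiplication are regular on \<open>X\<close>. It suffices
  to test nonnegativity on the rays: each step by a root lowers the value on \<open>p\<close> by one, which leaves
  it nonnegative for at most \<open>pairing p u\<close> steps, and does not lower the value on any
  other ray vector.
\<close>

lemma translate_by_root:
  assumes u: "u \<in> dual_semigroup \<sigma>" and e: "demazure_root \<sigma> p e" and k: "0 \<le> k" "k \<le> pairing p u"
  shows "u + k *s e \<in> dual_semigroup \<sigma>"
  unfolding dual_semigroup_def mem_Collect_eq
proof (rule dual_cone_if_nonneg_on_rays[OF polyhedral pointed])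
  fix q assume q: "q \<in> ray_vectors \<sigma>"
  then have "to_Q q \<in> \<sigma>"
    by (auto simp: ray_vectors_def primitive_on_def cone_ray_def cone_face_def)
  then have "0 \<le> pairing q u"
    using u by (metis dual_semigroup_iff of_int_0_le_iff pairingQ_to_Q)
  then have "0 \<le> pairing q u + k * pairing q e"
    using e k q by (cases "q = p") (auto simp: demazure_root_def)
  then show "0 \<le> pairingQ (to_Q q) (to_Q (u + k *s e))"
    by (simp only: pairingQ_to_Q pairing_add_right pairing_scale_right of_int_0_le_iff)
qed

lemma cone_ray_face_iff:
  assumes "cone_face \<gamma> \<sigma>"
  shows "cone_ray \<rho> \<gamma> \<longleftrightarrow> to_Q p \<in> \<gamma>"
proof
  show "to_Q p \<in> \<gamma>" if "cone_ray \<rho> \<gamma>"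
    using that primitive_in_ray by (auto simp: cone_ray_def cone_face_def)
next
  assume p: "to_Q p \<in> \<gamma>"
  obtain u where u: "\<gamma> = {v \<in> \<sigma>. pairingQ v u = 0}"
    using assms by (auto simp: cone_face_def)
  obtain w where w: "w \<in> dual_cone \<sigma>" "\<rho> = {v \<in> \<sigma>. pairingQ v w = 0}"
    using ray by (auto simp: cone_ray_def cone_face_def)
  have "\<rho> \<subseteq> \<gamma>"
  proof
    fix v assume v: "v \<in> \<rho>"
    then obtain c where "v = c *s to_Q p"
      by (rule ray_multiple)
    then show "v \<in> \<gamma>"
      using v p ray_subset by (auto simp: u pairingQ_scale_left)
  qed
  then have "\<rho> = {v \<in> \<gamma>. pairingQ v w = 0}"
    using w(2) by (auto simp: u)
  moreover have "w \<in> dual_cone \<gamma>"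
    using w(1) by (auto simp: u dual_cone_def)
  ultimately show "cone_ray \<rho> \<gamma>"
    using ray by (auto simp: cone_ray_def cone_face_def)
qed

lemma perp_cone_gen_ray_iff:
  "to_Q u \<in> perp (cone_gen (\<gamma> \<union> \<rho>)) \<longleftrightarrow> to_Q u \<in> perp \<gamma> \<and> pairing p u = 0"
proof -
  have "(\<forall>v\<in>\<rho>. pairingQ v (to_Q u) = 0) \<longleftrightarrow> pairing p u = 0"
  proof
    show "pairing p u = 0" if "\<forall>v\<in>\<rho>. pairingQ v (to_Q u) = 0"
      using that primitive_in_ray by (metis pairingQ_to_Q of_int_eq_0_iff)
    show "\<forall>v\<in>\<rho>. pairingQ v (to_Q u) = 0" if "pairing p u = 0"
      using that by (auto elim!: ray_multiple simp: pairingQ_scale_left pairingQ_to_Q)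
  qed
  then show ?thesis
    by (simp add: perp_cone_gen perp_iff[of _ \<gamma>] ball_Un)
qed

text \<open>
  A character to test idempotency with when \<open>\<rho>\<close> is not a ray of \<open>\<gamma>\<close>: an integral multiple of
  the functional that cuts out \<open>\<gamma>\<close>. It vanishes on \<open>\<gamma>\<close> but not on \<open>p\<close>.
\<close>

lemma exists_positive_weight:
  assumes "cone_face \<gamma> \<sigma>" "to_Q p \<notin> \<gamma>"
  obtains u where "u \<in> dual_semigroup \<sigma>" "to_Q u \<in> perp \<gamma>" "0 < pairing p u"
proof -
  obtain w where w: "w \<in> dual_cone \<sigma>" "\<gamma> = {v \<in> \<sigma>. pairingQ v w = 0}"
    using assms(1) by (auto simp: cone_face_def)
  obtain u d where u: "d > 0" "to_Q u = of_int d *s w"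
    using integral_multiple by blast
  have "u \<in> dual_semigroup \<sigma>"
    using w(1) u by (simp add: dual_semigroup_def dual_cone_def pairingQ_scale_right)
  moreover have "to_Q u \<in> perp \<gamma>"
    using u by (simp add: w(2) perp_iff pairingQ_scale_right)
  moreover have "pairing p u \<noteq> 0"
  proof
    assume "pairing p u = 0"
    then have "pairingQ (to_Q p) (to_Q u) = 0"
      by (simp add: pairingQ_to_Q)
    then have "pairingQ (to_Q p) w = 0"
      using u by (simp add: pairingQ_scale_right)
    then show False
      using assms(2) w(2) primitive_in_ray ray_subset by auto
  qed
  ultimately show thesis
    using that pairing_nonneg by (metis order_le_less)
qed

text \<open>
  In weight zero the binomial factor is trivial, and the equation reads \<open>c * c = c\<close> with
  \<open>c \<noteq> 0\<close>.
\<close>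

lemma idempotent_chr_eq_one:
  assumes "x \<in> idempotents \<sigma> p e1 e2" "x \<in> torus_orbit \<sigma> \<gamma>"
    and "u \<in> dual_semigroup \<sigma>" "to_Q u \<in> perp \<gamma>" "pairing p u = 0"
  shows "x (chr u) = 1"
proof -
  have "x \<in> toric_variety \<sigma>"
    using assms(1) by (simp add: idempotents_def)
  then have "point_mult \<sigma> p e1 e2 x x (chr u) = x (chr u)"
    using idempotent_iff assms(1,3) by blast
  then have "x (chr u) * x (chr u) = x (chr u)"
    by (simp add: point_mult_chr[OF assms(3)] assms(5))
  then show ?thesis
    using orbit_chr_eq_zero_iff[OF assms(2,3)] assms(4) by simp
qed

lemma orbit_square_chr_eq_zero:
  assumes x: "x \<in> torus_orbit \<sigma> \<gamma>" and u: "u \<in> dual_semigroup \<sigma>"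
    and out: "\<And>i j. 0 \<le> i \<Longrightarrow> 0 \<le> j \<Longrightarrow> i + j = pairing p u \<Longrightarrow>
      to_Q (u + i *s e2) \<notin> perp \<gamma> \<or> to_Q (u + j *s e1) \<notin> perp \<gamma>"
  shows "point_mult \<sigma> p e1 e2 x x (chr u) = 0"
  unfolding point_mult_chr[OF u]
proof (intro sum.neutral ballI)
  fix i assume "i \<in> {..nat (pairing p u)}"
  then have ij: "int i + int (nat (pairing p u) - i) = pairing p u"
    using pairing_nonneg[OF u] by auto
  have "u + int i *s e2 \<in> dual_semigroup \<sigma>"
    by (rule translate_by_root[OF u root2]) (use ij in linarith)+
  moreover have "u + int (nat (pairing p u) - i) *s e1 \<in> dual_semigroup \<sigma>"
    by (rule translate_by_root[OF u root1]) (use ij in linarith)+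
  ultimately show "of_nat (nat (pairing p u) choose i) * x (chr (u + int i *s e2))
      * x (chr (u + int (nat (pairing p u) - i) *s e1)) = 0"
    using out[OF _ _ ij] orbit_chr_eq_zero_iff[OF x] by auto
qed

text \<open>
  When \<open>p\<close> lies in \<open>\<gamma>\<close>, all of \<open>perp \<gamma>\<close> has weight zero. For a character \<open>u\<close> outside of \<open>perp \<gamma>\<close>,
  the factor with \<open>u + i *s e2\<close> has weight \<open>j\<close>, so it vanishes for \<open>j > 0\<close>; for \<open>j = 0\<close> the other
  factor is the value at \<open>u\<close> itself, which is zero.
\<close>

lemma distinguished_point_idempotent:
  assumes \<gamma>: "cone_face \<gamma> \<sigma>" and p: "to_Q p \<in> \<gamma>"
  shows "distinguished_point \<sigma> \<gamma> \<in> idempotents \<sigma> p e1 e2"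
proof -
  let ?x = "distinguished_point \<sigma> \<gamma>"
  have orbit: "?x \<in> torus_orbit \<sigma> \<gamma>"
    by (rule distinguished_point_in_orbit[OF \<gamma>])
  have weight: "pairing p u = 0" if "to_Q u \<in> perp \<gamma>" for u
    using that p by (auto simp: perp_iff pairingQ_to_Q)
  have "point_mult \<sigma> p e1 e2 ?x ?x (chr u) = ?x (chr u)" if u: "u \<in> dual_semigroup \<sigma>" for u
  proof (cases "to_Q u \<in> perp \<gamma>")
    case True
    then show ?thesis
      by (simp add: point_mult_chr[OF u] chr_distinguished_point u weight)
  next
    case False
    have "point_mult \<sigma> p e1 e2 ?x ?x (chr u) = 0"
    proof (rule orbit_square_chr_eq_zero[OF orbit u])
      fix i j :: int
      assume ij: "0 \<le> i" "0 \<le> j" "i + j = pairing p u"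
      have "pairing p (u + i *s e2) = j"
        using root2 ij by (simp add: pairing_add_right pairing_scale_right demazure_root_def)
      then show "to_Q (u + i *s e2) \<notin> perp \<gamma> \<or> to_Q (u + j *s e1) \<notin> perp \<gamma>"
        using weight[of "u + i *s e2"] False by (cases "j = 0") auto
    qed
    then show ?thesis
      by (simp add: chr_distinguished_point u False)
  qed
  then show ?thesis
    using orbit by (intro idempotent_iff[THEN iffD2]) (auto simp: torus_orbit_def)
qed

lemma idempotents_orbit_containing_ray:
  fixes \<gamma> :: "(rat^'n) set"
  assumes \<gamma>: "cone_face \<gamma> \<sigma>" and p: "to_Q p \<in> \<gamma>"
  shows "idempotents \<sigma> p e1 e2 \<inter> torus_orbit \<sigma> \<gamma>
    = {distinguished_point \<sigma> \<gamma> :: ('k::field, 'n) point}"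
proof -
  have "x = distinguished_point \<sigma> \<gamma>"
    if x: "x \<in> idempotents \<sigma> p e1 e2" "x \<in> torus_orbit \<sigma> \<gamma>" for x :: "('k, 'n) point"
  proof (rule toric_variety_eqI)
    show "x \<in> toric_variety \<sigma>" "distinguished_point \<sigma> \<gamma> \<in> toric_variety \<sigma>"
      using x distinguished_point_in_orbit[OF \<gamma>] by (auto simp: torus_orbit_def)
    fix u assume u: "u \<in> dual_semigroup \<sigma>"
    show "x (chr u) = distinguished_point \<sigma> \<gamma> (chr u)"
    proof (cases "to_Q u \<in> perp \<gamma>")
      case True
      then have "pairing p u = 0"
        using p by (auto simp: perp_iff pairingQ_to_Q)
      then show ?thesis
        using idempotent_chr_eq_one[OF x u True] True by (simp add: chr_distinguished_point u)
    next
      case False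
      then show ?thesis
        using orbit_chr_eq_zero_iff[OF x(2) u] by (simp add: chr_distinguished_point u)
    qed
  qed
  then show ?thesis
    using distinguished_point_idempotent[OF assms] distinguished_point_in_orbit[OF \<gamma>] by blast
qed

text \<open>
  For a character of positive weight in \<open>perp \<gamma>\<close>, a nonzero term would require \<open>i = 0\<close> and \<open>j = 0\<close>,
  contradicting \<open>i + j > 0\<close>. So the square of an orbit point vanishes where the point does not.
\<close>

lemma no_idempotents_if_no_root_in_perp:
  assumes \<gamma>: "cone_face \<gamma> \<sigma>" "to_Q p \<notin> \<gamma>"
    and e: "to_Q e1 \<notin> perp \<gamma>" "to_Q e2 \<notin> perp \<gamma>"
  shows "idempotents \<sigma> p e1 e2 \<inter> torus_orbit \<sigma> \<gamma> = {}"
proof (rule equals0I)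
  fix x assume "x \<in> idempotents \<sigma> p e1 e2 \<inter> torus_orbit \<sigma> \<gamma>"
  then have x: "x \<in> idempotents \<sigma> p e1 e2" "x \<in> torus_orbit \<sigma> \<gamma>" "x \<in> toric_variety \<sigma>"
    by (auto simp: idempotents_def)
  obtain u where u: "u \<in> dual_semigroup \<sigma>" "to_Q u \<in> perp \<gamma>" "0 < pairing p u"
    using exists_positive_weight[OF \<gamma>] .
  have "point_mult \<sigma> p e1 e2 x x (chr u) = 0"
  proof (rule orbit_square_chr_eq_zero[OF x(2) u(1)])
    fix i j :: int
    assume "i + j = pairing p u"
    then show "to_Q (u + i *s e2) \<notin> perp \<gamma> \<or> to_Q (u + j *s e1) \<notin> perp \<gamma>"
      using u(3) perp_translate_out[OF u(2) e(1), of j] perp_translate_out[OF u(2) e(2), of i]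
      by fastforce
  qed
  then have "x (chr u) = 0"
    using idempotent_iff[OF x(3)] x(1) u(1) by auto
  then show False
    using orbit_chr_eq_zero_iff[OF x(2) u(1)] u(2) by simp
qed

text \<open>
  Now \<open>perp \<gamma>\<close> is stable under both roots, so it contains a character \<open>u\<close> of weight one. The equation for
  \<open>u\<close>, divided by the value at \<open>u\<close>, says that the values at \<open>u + e1\<close> and \<open>u + e2\<close> add up to one;
  but both characters have weight zero, so both values are one.
\<close>

lemma no_idempotents_if_both_roots_in_perp:
  assumes \<gamma>: "cone_face \<gamma> \<sigma>" "to_Q p \<notin> \<gamma>"
    and e: "to_Q e1 \<in> perp \<gamma>" "to_Q e2 \<in> perp \<gamma>"
  shows "idempotents \<sigma> p e1 e2 \<inter> torus_orbit \<sigma> \<gamma> = {}"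
proof (rule equals0I)
  fix x assume "x \<in> idempotents \<sigma> p e1 e2 \<inter> torus_orbit \<sigma> \<gamma>"
  then have x: "x \<in> idempotents \<sigma> p e1 e2" "x \<in> torus_orbit \<sigma> \<gamma>" "x \<in> toric_variety \<sigma>"
    by (auto simp: idempotents_def)
  obtain w where w: "w \<in> dual_semigroup \<sigma>" "to_Q w \<in> perp \<gamma>" "0 < pairing p w"
    using exists_positive_weight[OF \<gamma>] .
  \<comment> \<open>Each step by \<open>e1\<close> lowers the weight by one.\<close>
  define u where "u = w + (pairing p w - 1) *s e1"
  have weight: "pairing p e1 = - 1"
    using root1 by (simp add: demazure_root_def)
  have u: "u \<in> dual_semigroup \<sigma>" "to_Q u \<in> perp \<gamma>" "pairing p u = 1"
    unfolding u_def using w(3) translate_by_root[OF w(1) root1, of "pairing p w - 1"]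
    by (simp_all only: perp_translate_iff[OF e(1)] w(2) pairing_add_right pairing_scale_right
        weight) simp_all
  have one: "x (chr (u + e)) = 1" if root: "demazure_root \<sigma> p e" and e: "to_Q e \<in> perp \<gamma>" for e
  proof (rule idempotent_chr_eq_one[OF x(1,2)])
    show "u + e \<in> dual_semigroup \<sigma>"
      using translate_by_root[OF u(1) root, of 1] u(3) by simp
    show "to_Q (u + e) \<in> perp \<gamma>"
      using perp_translate_iff[OF e, of u 1] u(2) by simp
    show "pairing p (u + e) = 0"
      using root u(3) by (simp add: pairing_add_right demazure_root_def)
  qed
  have "x (chr u) * x (chr (u + e1)) + x (chr (u + e2)) * x (chr u) = x (chr u)"
    using idempotent_iff[OF x(3), of p e1 e2] x(1) u(1,3) by (auto simp: point_mult_chr)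
  then have "x (chr u) = 0"
    by (simp only: one[OF root1 e(1)] one[OF root2 e(2)] mult_1_left mult_1_right add_cancel_left_right)
  then show False
    using orbit_chr_eq_zero_iff[OF x(2) u(1)] u(2) by simp
qed

text \<open>
  If only \<open>e1\<close> lies in \<open>perp \<gamma>\<close>, then \<open>u + j *s e1\<close> lies in \<open>perp \<gamma>\<close> exactly when \<open>u\<close> does, and then
  \<open>u + i *s e2\<close> does not for \<open>i > 0\<close>. Only the term with \<open>i = 0\<close> survives.
\<close>

lemma orbit_square_chr_if_first_root_in_perp:
  assumes e: "to_Q e1 \<in> perp \<gamma>" "to_Q e2 \<notin> perp \<gamma>"
    and x: "x \<in> torus_orbit \<sigma> \<gamma>" and u: "u \<in> dual_semigroup \<sigma>"
  shows "point_mult \<sigma> p e1 e2 x x (chr u) = x (chr u) * x (chr (u + pairing p u *s e1))"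
proof -
  let ?m = "nat (pairing p u)"
  let ?t = "\<lambda>i. of_nat (?m choose i) * x (chr (u + int i *s e2)) * x (chr (u + int (?m - i) *s e1))"
  have "?t i = 0" if i: "i \<le> ?m" "i \<noteq> 0" for i
  proof -
    have "u + int i *s e2 \<in> dual_semigroup \<sigma>"
      by (rule translate_by_root[OF u root2]) (use i(1) pairing_nonneg[OF u] in linarith)+
    moreover have "u + int (?m - i) *s e1 \<in> dual_semigroup \<sigma>"
      by (rule translate_by_root[OF u root1]) (use i(1) pairing_nonneg[OF u] in linarith)+
    moreover have "to_Q (u + int i *s e2) \<notin> perp \<gamma> \<or> to_Q (u + int (?m - i) *s e1) \<notin> perp \<gamma>"
      using perp_translate_out[OF _ e(2)] perp_translate_iff[OF e(1)] i(2) by auto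
    ultimately show ?thesis
      using orbit_chr_eq_zero_iff[OF x] by auto
  qed
  then have "(\<Sum>i\<le>?m. ?t i) = (\<Sum>i\<in>{0}. ?t i)"
    by (intro sum.mono_neutral_right) auto
  then show ?thesis
    unfolding point_mult_chr[OF u] using pairing_nonneg[OF u] by simp
qed

text \<open>
  The factor \<open>u + pairing p u *s e1\<close> of the surviving term has weight zero and lies in \<open>perp \<gamma>\<close>
  together with \<open>u\<close>. So idempotency reduces to the value one on the characters of weight zero in \<open>perp \<gamma>\<close>,
  and these are the ones orthogonal to both \<open>\<gamma>\<close> and \<open>\<rho>\<close>.
\<close>

lemma idempotents_orbit_if_first_root_in_perp:
  assumes e: "to_Q e1 \<in> perp \<gamma>" "to_Q e2 \<notin> perp \<gamma>"
  shows "idempotents \<sigma> p e1 e2 \<inter> torus_orbit \<sigma> \<gamma> = torus_orbit \<sigma> \<gamma> \<inter>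
    {x. \<forall>u\<in>dual_semigroup \<sigma>. to_Q u \<in> perp (cone_gen (\<gamma> \<union> \<rho>)) \<longrightarrow> x (chr u) = 1}"
proof -
  have "x \<in> idempotents \<sigma> p e1 e2"
    if x: "x \<in> torus_orbit \<sigma> \<gamma>"
      and one: "\<And>u. u \<in> dual_semigroup \<sigma> \<Longrightarrow> to_Q u \<in> perp \<gamma> \<Longrightarrow> pairing p u = 0 \<Longrightarrow> x (chr u) = 1"
    for x
  proof -
    have "point_mult \<sigma> p e1 e2 x x (chr u) = x (chr u)" if u: "u \<in> dual_semigroup \<sigma>" for u
    proof (cases "to_Q u \<in> perp \<gamma>")
      case True
      have "x (chr (u + pairing p u *s e1)) = 1"
      proof (rule one)
        show "u + pairing p u *s e1 \<in> dual_semigroup \<sigma>"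
          using translate_by_root[OF u root1] pairing_nonneg[OF u] by simp
        show "to_Q (u + pairing p u *s e1) \<in> perp \<gamma>"
          using True by (simp add: perp_translate_iff[OF e(1)])
        show "pairing p (u + pairing p u *s e1) = 0"
          using root1 by (simp add: pairing_add_right pairing_scale_right demazure_root_def)
      qed
      then show ?thesis
        by (simp add: orbit_square_chr_if_first_root_in_perp[OF e x u])
    next
      case False
      then have "x (chr u) = 0"
        using orbit_chr_eq_zero_iff[OF x u] by simp
      then show ?thesis
        by (simp add: orbit_square_chr_if_first_root_in_perp[OF e x u])
    qed
    moreover have "x \<in> toric_variety \<sigma>"
      using x by (simp add: torus_orbit_def)
    ultimately show ?thesis
      by (simp add: idempotent_iff)
  qed
  then show ?thesis
    by (auto simp: perp_cone_gen_ray_iff idempotent_chr_eq_one)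
qed

end

theorem theorem3:
  fixes \<sigma> \<rho> \<gamma> :: "(rat^'n::finite) set" and p e1 e2 :: "int^'n"
    and E :: "('k::{alg_closed_field, field_char_0}, 'n::finite) point set"
  assumes "polyhedral_cone \<sigma>" and "strongly_convex \<sigma>"
    and "cone_ray \<rho> \<sigma>" and "primitive_on p \<rho>"
    and "demazure_root \<sigma> p e1" and "demazure_root \<sigma> p e2"
    and "cone_face \<gamma> \<sigma>"
  defines "E \<equiv> idempotents \<sigma> p e1 e2 \<inter> torus_orbit \<sigma> \<gamma>"
  shows "(cone_ray \<rho> \<gamma> \<longrightarrow> E = {distinguished_point \<sigma> \<gamma>}) \<and>
    (\<not> cone_ray \<rho> \<gamma> \<and> to_Q e1 \<notin> perp \<gamma> \<and> to_Q e2 \<notin> perp \<gamma> \<longrightarrow> E = {}) \<and>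
    (\<not> cone_ray \<rho> \<gamma> \<and> to_Q e1 \<in> perp \<gamma> \<and> to_Q e2 \<in> perp \<gamma> \<longrightarrow> E = {}) \<and>
    (\<not> cone_ray \<rho> \<gamma> \<and> (to_Q e1 \<in> perp \<gamma> \<longleftrightarrow> to_Q e2 \<notin> perp \<gamma>) \<longrightarrow>
       E = torus_orbit \<sigma> \<gamma> \<inter>
         {x. \<forall>u\<in>dual_semigroup \<sigma>. to_Q u \<in> perp (cone_gen (\<gamma> \<union> \<rho>)) \<longrightarrow> x (chr u) = 1})"
proof -
  interpret corank_one_monoid \<sigma> \<rho> p e1 e2
    by unfold_locales fact+
  interpret opp: corank_one_monoid \<sigma> \<rho> p e2 e1
    by (rule opposite)
  note \<gamma> = \<open>cone_face \<gamma> \<sigma>\<close>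
  show ?thesis
    unfolding E_def cone_ray_face_iff[OF \<gamma>]
  proof (intro conjI impI, goal_cases a b c d)
    case a
    then show ?case
      by (rule idempotents_orbit_containing_ray[OF \<gamma>])
  next
    case b
    then show ?case
      by (intro no_idempotents_if_no_root_in_perp[OF \<gamma>]) simp_all
  next
    case c
    then show ?case
      by (intro no_idempotents_if_both_roots_in_perp[OF \<gamma>]) simp_all
  next
    case d
    then have exactly_one: "to_Q e1 \<in> perp \<gamma> \<longleftrightarrow> to_Q e2 \<notin> perp \<gamma>"
      by blast
    show ?case
    proof (cases "to_Q e1 \<in> perp \<gamma>")
      case True
      then show ?thesis
        using exactly_one by (intro idempotents_orbit_if_first_root_in_perp) simp_all
    next
      case False
      then show ?thesis
        unfolding idempotents_opposite[of \<sigma> p e1 e2]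
        using exactly_one by (intro opp.idempotents_orbit_if_first_root_in_perp) simp_all
    qed
  qed
qed

end
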